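(* Let $\langle\chi,\vec a\rangle$ be a loop and $\check\phi$ a quantifier-free formula over $\vec x$, where $\chi(\vec x)\equiv\bigwedge_{i=1}^k C_i$ in CNF and each clause $C_i$ contains an inequation $e_i(\vec x)>0$ (as one of its disjuncts) such that \[ \check\phi(\vec x)\land e_i(\vec x)\le e_i(\vec a(\vec x))\implies e_i(\vec a(\vec x))\le e_i(\vec a^2(\vec x)) \] is valid. Then the conditional acceleration technique mapping $(\langle\chi,\vec a\rangle,\check\phi)$ to \[ \vec x'=\vec a^n(\vec x)\land\bigwedge_{i=1}^k 0<e_i(\vec x)\le e_i(\vec a(\vec x)) \] is sound, i.e., for all $\vec x,\vec x'\in\mathbb Z^d$ and all $n>0$, $\vec x\longrightarrow^n_{\langle\check\phi,\vec a\rangle}\vec x'$ together with this formula implies $\vec x\longrightarrow^n_{\langle\chi,\vec a\rangle}\vec x'$.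
   Context: Fix $d\ge 1$, integer variables $\vec x=(x_1,\dots,x_d)$, $\vec x'$, and $n$ ranging over $\mathbb N$. A loop $\langle\chi,\vec a\rangle$ consists of a quantifier-free formula $\chi$ over atoms $p>0$ ($p$ an arithmetic expression over $\vec x$, integer semantics) and a map $\vec a:\mathbb Z^d\to\mathbb Z^d$ given by expressions over $\vec x$; $\vec a^m$ is $m$-fold application. $\vec x\longrightarrow_{\langle\chi,\vec a\rangle}\vec x'$ iff $\chi(\vec x)\land\vec x'=\vec a(\vec x)$, and $\longrightarrow^m$ is its $m$-fold composition; thus $\vec x\longrightarrow^m_{\langle\chi,\vec a\rangle}\vec x'$ iff $\vec x'=\vec a^m(\vec x)$ and $\chi(\vec a^i(\vec x))$ for all $0\le i<m$. Validity means truth for all integer values of the free variables. *)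

theory Defs
  imports "HOL-Analysis.Finite_Cartesian_Product"
begin

type_synonym 'd state = "int ^ 'd"

text \<open>
  The operators of arithmetic expressions beyond addition, subtraction and multiplication
  (division, exponentiation, ...) are not fixed: \<open>Op\<close> carries the interpretation of an arbitrary
  total binary operator on the integers, e.g. \<open>(div)\<close> or \<open>\<lambda>a b. a ^ nat b\<close>.
\<close>

datatype 'd aexp =
    Const int
  | Var 'd
  | Add "'d aexp" "'d aexp"
  | Sub "'d aexp" "'d aexp"
  | Mul "'d aexp" "'d aexp"
  | Op "int \<Rightarrow> int \<Rightarrow> int" "'d aexp" "'d aexp"

primrec aval :: "'d::finite aexp \<Rightarrow> 'd state \<Rightarrow> int" where
  "aval (Const c) x = c"
| "aval (Var j) x = x $ j"
| "aval (Add p q) x = aval p x + aval q x"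
| "aval (Sub p q) x = aval p x - aval q x"
| "aval (Mul p q) x = aval p x * aval q x"
| "aval (Op f p q) x = f (aval p x) (aval q x)"

text \<open>Quantifier-free formulas; the atom \<open>Pos p\<close> is the inequation \<open>p > 0\<close>.\<close>

datatype 'd qf =
    Pos "'d aexp"
  | Tru
  | Fls
  | Neg "'d qf"
  | Conj "'d qf" "'d qf"
  | Disj "'d qf" "'d qf"

primrec sat :: "'d::finite qf \<Rightarrow> 'd state \<Rightarrow> bool" where
  "sat (Pos p) x \<longleftrightarrow> aval p x > 0"
| "sat Tru x \<longleftrightarrow> True"
| "sat Fls x \<longleftrightarrow> False"
| "sat (Neg f) x \<longleftrightarrow> \<not> sat f x"
| "sat (Conj f g) x \<longleftrightarrow> sat f x \<and> sat g x"
| "sat (Disj f g) x \<longleftrightarrow> sat f x \<or> sat g x"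

definition equivalent :: "'d::finite qf \<Rightarrow> 'd qf \<Rightarrow> bool" where
  "equivalent f g \<longleftrightarrow> (\<forall>x. sat f x \<longleftrightarrow> sat g x)"

definition is_literal :: "'d qf \<Rightarrow> bool" where
  "is_literal f \<longleftrightarrow> (\<exists>p. f = Pos p \<or> f = Neg (Pos p))"

definition is_clause :: "'d qf list \<Rightarrow> bool" where
  "is_clause C \<longleftrightarrow> (\<forall>l\<in>set C. is_literal l)"

definition cnf :: "'d qf list list \<Rightarrow> 'd qf" where
  "cnf Cs = foldr Conj (map (\<lambda>C. foldr Disj C Fls) Cs) Tru"

text \<open>A loop consists of its guard and one update expression per variable.\<close>

type_synonym 'd loop = "'d qf \<times> ('d aexp ^ 'd)"

definition update :: "'d::finite aexp ^ 'd \<Rightarrow> 'd state \<Rightarrow> 'd state" where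
  "update a x = (\<chi> j. aval (a $ j) x)"

fun step :: "'d::finite loop \<Rightarrow> 'd state \<Rightarrow> 'd state \<Rightarrow> bool" where
  "step (g, a) x x' \<longleftrightarrow> sat g x \<and> x' = update a x"

text \<open>
  \<open>cond_accel_sound L f \<psi>\<close>: mapping the loop \<open>L\<close> and the formula \<open>f\<close> to \<open>\<psi>\<close>, a formula over
  \<open>x\<close>, \<open>n\<close>, \<open>x'\<close>, is a sound conditional acceleration. \<open>\<psi>\<close> is a predicate rather than a syntactic
  formula since it may involve the \<open>n\<close>-fold iteration of the update for symbolic \<open>n\<close>.
\<close>

fun cond_accel_sound ::
  "'d::finite loop \<Rightarrow> 'd qf \<Rightarrow> ('d state \<Rightarrow> nat \<Rightarrow> 'd state \<Rightarrow> bool) \<Rightarrow> bool" where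
  "cond_accel_sound (g, a) f \<psi> \<longleftrightarrow>
    (\<forall>x x' n. n > 0 \<longrightarrow> (step (f, a) ^^ n) x x' \<longrightarrow> \<psi> x n x' \<longrightarrow> (step (g, a) ^^ n) x x')"

end

theory Submission
  imports Defs
begin

text \<open>
  Along a run of \<open>\<langle>f, a\<rangle>\<close> the hypothesis on \<open>e\<^sub>i\<close> propagates \<open>e\<^sub>i(x) \<le> e\<^sub>i(a(x))\<close> from each state
  to the next, so \<open>e\<^sub>i\<close> is nondecreasing and stays positive. Hence every clause, and thus the
  guard, holds in each state of the run.
\<close>

text \<open>\<open>update a\<close> is a function, so the start determines the whole run. The guard
  is tested before each update, hence at the iterates \<open>m < n\<close> but not at the final
  state.\<close>

lemma step_relpowp_iff:
  "(step (g, a) ^^ n) x x' \<longleftrightarrow>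
    x' = (update a ^^ n) x \<and> (\<forall>m<n. sat g ((update a ^^ m) x))"
  by (induction n arbitrary: x') (auto simp: OO_def less_Suc_eq)

lemma sat_foldr_Disj: "sat (foldr Disj C Fls) x \<longleftrightarrow> (\<exists>l\<in>set C. sat l x)"
  by (induction C) auto

lemma sat_cnf: "sat (cnf Cs) x \<longleftrightarrow> (\<forall>C\<in>set Cs. \<exists>l\<in>set C. sat l x)"
  unfolding cnf_def by (induction Cs) (auto simp: sat_foldr_Disj)

text \<open>The induction needs both conjuncts together: the inequality at one iterate carries
  positivity to the next, and \<open>incr\<close> carries the inequality itself.\<close>

lemma eventually_increasing_pos:
  fixes u :: "'a \<Rightarrow> 'a" and v :: "'a \<Rightarrow> 'b::{preorder,zero}"
  assumes incr: "\<And>y. P y \<Longrightarrow> v y \<le> v (u y) \<Longrightarrow> v (u y) \<le> v (u (u y))"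
    and run: "\<And>k. k < m \<Longrightarrow> P ((u ^^ k) x)"
    and init: "0 < v x" "v x \<le> v (u x)"
  shows "0 < v ((u ^^ m) x) \<and> v ((u ^^ m) x) \<le> v (u ((u ^^ m) x))"
  using run
proof (induction m)
  case 0
  then show ?case using init by simp
next
  case (Suc m)
  then have "0 < v ((u ^^ m) x)" and le: "v ((u ^^ m) x) \<le> v (u ((u ^^ m) x))"
    by simp_all
  then have "0 < v (u ((u ^^ m) x))"
    by (rule less_le_trans)
  \<comment> \<open>\<open>lessI\<close> selects \<open>P\<close> at iterate \<open>m\<close>, the
    last index below \<open>Suc m\<close>.\<close>
  then show ?case
    using incr[OF Suc.prems[OF lessI] le] by simp
qed

theorem theorem13:
  fixes g f :: "'d::finite qf"
    and a :: "'d aexp ^ 'd"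
    and Cs :: "'d qf list list"
    and e :: "nat \<Rightarrow> 'd aexp"
  assumes "\<forall>C\<in>set Cs. is_clause C"
    and "equivalent g (cnf Cs)"
    and "\<forall>i<length Cs. Pos (e i) \<in> set (Cs ! i)"
    and "\<forall>i<length Cs. \<forall>x.
      sat f x \<and> aval (e i) x \<le> aval (e i) (update a x) \<longrightarrow>
      aval (e i) (update a x) \<le> aval (e i) ((update a ^^ 2) x)"
  shows "cond_accel_sound (g, a) f (\<lambda>x n x'. x' = (update a ^^ n) x \<and>
    (\<forall>i<length Cs. 0 < aval (e i) x \<and> aval (e i) x \<le> aval (e i) (update a x)))"
proof -
  have "sat g ((update a ^^ m) x)"
    if run: "\<forall>k<n. sat f ((update a ^^ k) x)"
      and init: "\<forall>i<length Cs. 0 < aval (e i) x \<and> aval (e i) x \<le> aval (e i) (update a x)"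
      and "m < n" for x n m
  proof -
    have "\<exists>l\<in>set (Cs ! i). sat l ((update a ^^ m) x)" if i: "i < length Cs" for i
    proof
      \<comment> \<open>The witness in each clause is its designated literal
        \<open>Pos (e i)\<close>.\<close>
      have "0 < aval (e i) ((update a ^^ m) x)"
        \<comment> \<open>As \<open>m < n\<close>, \<open>run\<close> provides \<open>f\<close> at
          all iterates below \<open>m\<close>; \<open>numeral_2_eq_2\<close> unfolds
          \<open>update a ^^ 2\<close> into two applications.\<close>
        using eventually_increasing_pos[where P = "sat f" and u = "update a" and v = "aval (e i)"
            and m = m and x = x] assms(4) run init i \<open>m < n\<close>
        by (simp add: numeral_2_eq_2)
      then show "sat (Pos (e i)) ((update a ^^ m) x)" by simp
      show "Pos (e i) \<in> set (Cs ! i)" using assms(3) i by blast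
    qed
    then have "sat (cnf Cs) ((update a ^^ m) x)"
      by (simp add: sat_cnf all_set_conv_all_nth)
    then show ?thesis
      using assms(2) by (simp add: equivalent_def)
  qed
  then show ?thesis
    by (auto simp: step_relpowp_iff)
qed

end
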